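(* Let $(\mathcal{A},\Phi,\mathcal{D})$ be a pre-number system with $\bigcap_{m\in\mathbb{N}_0}\Phi^m(\mathcal{A})=\{0\}$, and let $w$ be a positive integer. Then the following statements are equivalent: (i) The digit set $\mathcal{D}$ is $w$-subadditive. (ii) For every multi-expansion $\boldsymbol{\mu}$ there is a $w$-NAF-expansion $\boldsymbol{\xi}$ such that $\mathrm{value}(\boldsymbol{\xi})=\mathrm{value}(\boldsymbol{\mu})$ and $\mathrm{weight}(\boldsymbol{\xi})\le\mathrm{weight}(\boldsymbol{\mu})$. (iii) For all $w$-NAF-expansions $\boldsymbol{\eta}$ and $\boldsymbol{\vartheta}$ there is a $w$-NAF-expansion $\boldsymbol{\xi}$ such that $\mathrm{value}(\boldsymbol{\xi})=\mathrm{value}(\boldsymbol{\eta})+\mathrm{value}(\boldsymbol{\vartheta})$ and $\mathrm{weight}(\boldsymbol{\xi})\le\mathrm{weight}(\boldsymbol{\eta})+\mathrm{weight}(\boldsymbol{\vartheta})$. (iv) If $z\in\mathcal{A}$ admits a multi-expansion, then $z$ also admits an optimal $w$-NAF-expansion.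
   Context: A pre-number system is a triple $(\mathcal{A},\Phi,\mathcal{D})$ where $\mathcal{A}$ is an Abelian group, $\Phi$ is a group endomorphism of $\mathcal{A}$, and the digit set $\mathcal{D}\subseteq\mathcal{A}$ satisfies $0\in\mathcal{D}$ and no non-zero digit lies in $\Phi(\mathcal{A})$. $\Phi^n$ denotes the $n$-fold iterate ($\Phi^0=\mathrm{id}$). A multi-expansion is a finite multiset $\boldsymbol{\mu}$ of pairs $(d,n)\in(\mathcal{D}\setminus\{0\})\times\mathbb{N}_0$ (possibly empty). Its weight $\mathrm{weight}(\boldsymbol{\mu})$ is its cardinality (with multiplicity) and its value is $\mathrm{value}(\boldsymbol{\mu})=\sum_{(d,n)\in\boldsymbol{\mu}}\Phi^n(d)$. It is a multi-expansion of $z\in\mathcal{A}$ if its value is $z$. A singleton is a pair $(d,n)\in(\mathcal{D}\setminus\{0\})\times\mathbb{N}_0$; its value is $\Phi^n(d)$. An expansion is a multi-expansion in which the second components $n$ are pairwise distinct; it is identified with the finitely supported sequence $(\eta_n)_{n\in\mathbb{N}_0}\in\mathcal{D}^{\mathbb{N}_0}$ with $\eta_n=d$ if $(d,n)$ is in it and $\eta_n=0$ otherwise. A $w$-NAF-expansion is an expansion such that every block $\eta_{j+w-1}\ldots\eta_j$ ($j\in\mathbb{N}_0$) of $w$ consecutive entries contains at most one non-zero digit. A multi-expansion (or expansion) $\boldsymbol{\mu}$ of $z$ is optimal if $\mathrm{weight}(\boldsymbol{\mu})\le\mathrm{weight}(\boldsymbol{\nu})$ for every multi-expansion $\boldsymbol{\nu}$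 of $z$. The digit set $\mathcal{D}$ is $w$-subadditive if the sum of the values of any two singletons has a $w$-NAF-expansion of weight at most $2$. *)

theory Defs
  imports Complex_Main "HOL-Library.Multiset"
begin

locale pre_number_system = additive \<Phi>
  for \<Phi> :: "'a::ab_group_add \<Rightarrow> 'a" +
  fixes D :: "'a set"
  assumes zero_digit: "0 \<in> D"
    and nonzero_digit_notin_range: "d \<in> D \<Longrightarrow> d \<noteq> 0 \<Longrightarrow> d \<notin> range \<Phi>"

definition singletons :: "'a::zero set \<Rightarrow> ('a \<times> nat) set" where
  "singletons D = (D - {0}) \<times> UNIV"

definition singleton_value :: "('a \<Rightarrow> 'a) \<Rightarrow> 'a \<times> nat \<Rightarrow> 'a" where
  "singleton_value \<Phi> = (\<lambda>(d, n). (\<Phi> ^^ n) d)"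

definition multi_expansion :: "'a::zero set \<Rightarrow> ('a \<times> nat) multiset \<Rightarrow> bool" where
  "multi_expansion D \<mu> \<longleftrightarrow> set_mset \<mu> \<subseteq> singletons D"

abbreviation weight :: "('a \<times> nat) multiset \<Rightarrow> nat" where
  "weight \<mu> \<equiv> size \<mu>"

definition expansion_value :: "('a::comm_monoid_add \<Rightarrow> 'a) \<Rightarrow> ('a \<times> nat) multiset \<Rightarrow> 'a" where
  "expansion_value \<Phi> \<mu> = (\<Sum>p\<in>#\<mu>. singleton_value \<Phi> p)"

definition expansion :: "'a::zero set \<Rightarrow> ('a \<times> nat) multiset \<Rightarrow> bool" where
  "expansion D \<mu> \<longleftrightarrow> multi_expansion D \<mu> \<and> (\<forall>n. count (image_mset snd \<mu>) n \<le> 1)"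

(* The sequence identified with an expansion. For a multi-expansion with repeated
   second components the description below may be undefined. *)
definition digit :: "('a::zero \<times> nat) multiset \<Rightarrow> nat \<Rightarrow> 'a" where
  "digit \<mu> n = (if \<exists>d. (d, n) \<in># \<mu> then THE d. (d, n) \<in># \<mu> else 0)"

definition w_NAF_expansion :: "nat \<Rightarrow> 'a::zero set \<Rightarrow> ('a \<times> nat) multiset \<Rightarrow> bool" where
  "w_NAF_expansion w D \<mu> \<longleftrightarrow>
     expansion D \<mu> \<and> (\<forall>j. card {i \<in> {j..<j + w}. digit \<mu> i \<noteq> 0} \<le> 1)"

definition optimal ::
  "('a::comm_monoid_add \<Rightarrow> 'a) \<Rightarrow> 'a set \<Rightarrow> ('a \<times> nat) multiset \<Rightarrow> bool" where
  "optimal \<Phi> D \<mu> \<longleftrightarrow> multi_expansion D \<mu> \<and>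
     (\<forall>\<nu>. multi_expansion D \<nu> \<and> expansion_value \<Phi> \<nu> = expansion_value \<Phi> \<mu>
        \<longrightarrow> weight \<mu> \<le> weight \<nu>)"

definition w_subadditive ::
  "nat \<Rightarrow> ('a::comm_monoid_add \<Rightarrow> 'a) \<Rightarrow> 'a set \<Rightarrow> bool" where
  "w_subadditive w \<Phi> D \<longleftrightarrow>
     (\<forall>s \<in> singletons D. \<forall>t \<in> singletons D. \<exists>\<xi>. w_NAF_expansion w D \<xi> \<and>
        expansion_value \<Phi> \<xi> = singleton_value \<Phi> s + singleton_value \<Phi> t \<and> weight \<xi> \<le> 2)"

end

theory Submission
  imports Defs
begin

text \<open>
  Every implication except (i) to (ii) is short. A sum of two expansions is a multi-expansion, which
  gives (iii) from (ii); a single singleton is already a \<open>w\<close>-NAF, which gives (i) from (iii); and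
  (iv) follows from (ii) applied to a multi-expansion of least weight. Conversely, an optimal
  \<open>w\<close>-NAF of the value of a multi-expansion weighs no more than that multi-expansion, which is (ii).

  For (i) to (ii), the naive procedure replaces two singletons that are too close by the \<open>w\<close>-NAF of
  their sum. This never increases the weight, but pushes positions upwards, so it need not be clear
  that it stops. Strong induction on the weight together with an extremal choice avoids the question.
  For a value \<open>z \<noteq> 0\<close>, the hypothesis that the ranges of the iterates of \<open>\<Phi>\<close> intersect in \<open>{0}\<close>
  bounds the lowest position occurring in any multi-expansion of \<open>z\<close>, because all positions being at
  least \<open>p\<close> puts \<open>z\<close> into the range of \<open>\<Phi>\<^sup>p\<close>. Hence, among the multi-expansions of \<open>z\<close> whose weight
  is not larger than the given one, there is one whose lowest position \<open>p\<close> is largest. Split off a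
  singleton \<open>x\<close> at position \<open>p\<close>, and replace the rest by a \<open>w\<close>-NAF by induction. If its lowest
  singleton \<open>y\<close> is at distance at least \<open>w\<close> from \<open>x\<close>, nothing is left to do. Otherwise \<open>x\<close> and \<open>y\<close>
  are exchanged for a \<open>w\<close>-NAF \<open>{a, b}\<close> of their sum (lemma \<open>exchange_close_singletons\<close>). The lower
  one, \<open>a\<close>, sits at position \<open>p\<close> again: if \<open>y\<close> was above \<open>p\<close>, because a nonzero digit is never
  in the range of \<open>\<Phi>\<close>; if \<open>y\<close> was at \<open>p\<close>, because of the maximality of \<open>p\<close>. All the other
  singletons now have positions at least \<open>p + w\<close>, so a second use of the induction hypothesis, now
  on everything but \<open>a\<close>, finishes the proof. If instead the \<open>w\<close>-NAF of the sum of \<open>x\<close> and \<open>y\<close> has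
  fewer than two members, the exchange has lowered the total weight, and the induction hypothesis
  applies to the whole.

  Since \<open>\<Phi>\<close> is additive, values commute with shifting all positions by \<open>p\<close>; this transports
  statements about multi-expansions to those living on positions at least \<open>p\<close>.
\<close>

section \<open>Spacing of the positions in a non-adjacent form\<close>

text \<open>
  The form in which the \<open>w\<close>-NAF condition is used below: it refers only to pairs of members, so it
  behaves well under removing members and shifting. Pairs are submultisets, so that a repeated
  singleton is compared with itself and thereby excluded when \<open>w\<close> is positive.
\<close>
definition spaced :: "nat \<Rightarrow> ('a \<times> nat) multiset \<Rightarrow> bool" where
  "spaced w \<mu> \<longleftrightarrow>
     (\<forall>x y. {#x, y#} \<subseteq># \<mu> \<longrightarrow> snd x + w \<le> snd y \<or> snd y + w \<le> snd x)"

definition above :: "nat \<Rightarrow> ('a \<times> nat) multiset \<Rightarrow> bool" where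
  "above p \<mu> \<longleftrightarrow> (\<forall>x\<in>#\<mu>. p \<le> snd x)"

lemma multi_expansion_simps [simp]:
  "multi_expansion D {#}"
  "multi_expansion D (add_mset x \<mu>) \<longleftrightarrow> x \<in> singletons D \<and> multi_expansion D \<mu>"
  "multi_expansion D (\<mu> + \<nu>) \<longleftrightarrow> multi_expansion D \<mu> \<and> multi_expansion D \<nu>"
  by (auto simp: multi_expansion_def)

lemma above_simps [simp]:
  "above p {#}"
  "above p (add_mset x \<mu>) \<longleftrightarrow> p \<le> snd x \<and> above p \<mu>"
  "above p (\<mu> + \<nu>) \<longleftrightarrow> above p \<mu> \<and> above p \<nu>"
  by (auto simp: above_def)

lemma above_mono: "above q \<mu> \<Longrightarrow> p \<le> q \<Longrightarrow> above p \<mu>"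
  by (auto simp: above_def)

lemma expansion_value_simps [simp]:
  "expansion_value \<Phi> {#} = 0"
  "expansion_value \<Phi> (add_mset x \<mu>) = singleton_value \<Phi> x + expansion_value \<Phi> \<mu>"
  "expansion_value \<Phi> (\<mu> + \<nu>) = expansion_value \<Phi> \<mu> + expansion_value \<Phi> \<nu>"
  by (auto simp: expansion_value_def)

lemma spaced_empty [simp]: "spaced w {#}"
  by (simp add: spaced_def)

lemma pair_subseteq_add_mset_cases:
  assumes "{#x, y#} \<subseteq># add_mset z \<mu>"
  shows "{#x, y#} \<subseteq># \<mu> \<or> (x = z \<and> y \<in># \<mu>) \<or> (y = z \<and> x \<in># \<mu>)"
proof (cases "x = z")
  case True
  with assms show ?thesis by simp
next
  case False
  show ?thesis
  proof (cases "y = z")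
    case True
    with assms show ?thesis by (simp add: add_mset_commute[of x])
  next
    case y: False
    have "{#x, y#} - {#z#} \<subseteq># \<mu>"
      using assms by (simp add: subset_eq_diff_conv)
    with False y show ?thesis by (simp add: diff_union_swap2)
  qed
qed

lemma spaced_add_mset:
  "spaced w (add_mset z \<mu>) \<longleftrightarrow>
     spaced w \<mu> \<and> (\<forall>y\<in>#\<mu>. snd z + w \<le> snd y \<or> snd y + w \<le> snd z)"
proof (intro iffI conjI ballI)
  assume sp: "spaced w (add_mset z \<mu>)"
  show "spaced w \<mu>"
    using sp unfolding spaced_def
    by (metis subset_mset.order_trans mset_subset_eq_add_left add_mset_add_single)
  fix y assume "y \<in># \<mu>"
  then have "{#z, y#} \<subseteq># add_mset z \<mu>" by simp
  then show "snd z + w \<le> snd y \<or> snd y + w \<le> snd z"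
    using sp unfolding spaced_def by blast
next
  assume "spaced w \<mu> \<and> (\<forall>y\<in>#\<mu>. snd z + w \<le> snd y \<or> snd y + w \<le> snd z)"
  then show "spaced w (add_mset z \<mu>)"
    unfolding spaced_def using pair_subseteq_add_mset_cases by metis
qed

lemma spaced_imp_count_position_le_1:
  assumes "spaced w \<mu>" "w > 0"
  shows "count (image_mset snd \<mu>) n \<le> 1"
  using assms(1)
proof (induction \<mu>)
  case (add z \<mu>)
  have "n \<notin> snd ` set_mset \<mu>" if "snd z = n"
    using add.prems that \<open>w > 0\<close> by (force simp: spaced_add_mset)
  then have "count (image_mset snd \<mu>) n = 0" if "snd z = n"
    using that by (metis count_eq_zero_iff set_image_mset)
  with add show ?case by (auto simp: spaced_add_mset)
qed simp

text \<open>
  In an expansion there is at most one pair for each position, so the description operator in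
  \<^const>\<open>digit\<close> is applied to a unique witness.
\<close>
lemma digit_eq:
  assumes "expansion D \<mu>" "(d, n) \<in># \<mu>"
  shows "digit \<mu> n = d"
proof -
  have "e = d" if "(e, n) \<in># \<mu>" for e
  proof (rule ccontr)
    assume "e \<noteq> d"
    with assms(2) that obtain \<nu> where "\<mu> = add_mset (e, n) (add_mset (d, n) \<nu>)"
      by (metis insert_noteq_member multi_member_split prod.inject)
    then have "count (image_mset snd \<mu>) n \<ge> 2" by simp
    with assms(1) show False
      unfolding expansion_def by (metis Suc_1 not_less_eq_eq One_nat_def)
  qed
  then have "(THE e. (e, n) \<in># \<mu>) = d"
    using assms(2) by blast
  with assms(2) show ?thesis by (metis digit_def)
qed

lemma digit_nonzeroD: "expansion D \<mu> \<Longrightarrow> digit \<mu> n \<noteq> 0 \<Longrightarrow> (digit \<mu> n, n) \<in># \<mu>"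
  using digit_eq[of D \<mu> _ n] by (cases "\<exists>d. (d, n) \<in># \<mu>") (auto simp: digit_def[of \<mu> n])

lemma w_NAF_expansion_iff_spaced:
  assumes "w > 0"
  shows "w_NAF_expansion w D \<mu> \<longleftrightarrow> multi_expansion D \<mu> \<and> spaced w \<mu>"
proof (intro iffI conjI)
  assume naf: "w_NAF_expansion w D \<mu>"
  then have ex: "expansion D \<mu>" and
    sparse: "\<And>j. card {i \<in> {j..<j + w}. digit \<mu> i \<noteq> 0} \<le> 1"
    by (auto simp: w_NAF_expansion_def)
  then show multi: "multi_expansion D \<mu>" by (simp add: expansion_def)
  have less: False
    if "x \<in># \<mu>" "y \<in># \<mu>" "snd x < snd y" "snd y < snd x + w" for x y
  proof -
    have "digit \<mu> (snd v) \<noteq> 0" if "v \<in># \<mu>" for v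
      using digit_eq[OF ex, of "fst v" "snd v"] that multi
      by (auto simp: multi_expansion_def singletons_def)
    then have "{snd x, snd y} \<subseteq> {i \<in> {snd x..<snd x + w}. digit \<mu> i \<noteq> 0}"
      using that by auto
    then have "card {snd x, snd y} \<le> card {i \<in> {snd x..<snd x + w}. digit \<mu> i \<noteq> 0}"
      by (intro card_mono) auto
    also have "\<dots> \<le> 1" by (rule sparse)
    finally have "card {snd x, snd y} \<le> 1" .
    with that(3) show False by simp
  qed
  show "spaced w \<mu>"
    unfolding spaced_def
  proof (intro allI impI)
    fix x y assume sub: "{#x, y#} \<subseteq># \<mu>"
    then obtain \<nu> where \<nu>: "\<mu> = {#x, y#} + \<nu>" by (metis subset_mset.le_iff_add)
    have "snd x \<noteq> snd y"
    proof
      assume "snd x = snd y"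
      with \<nu> have "count (image_mset snd \<mu>) (snd x) \<ge> 2" by simp
      with ex show False
        unfolding expansion_def by (metis Suc_1 not_less_eq_eq One_nat_def)
    qed
    with less[of x y] less[of y x] \<nu>
    show "snd x + w \<le> snd y \<or> snd y + w \<le> snd x"
      by (force simp: not_less[symmetric])
  qed
next
  assume R: "multi_expansion D \<mu> \<and> spaced w \<mu>"
  then have ex: "expansion D \<mu>"
    using assms unfolding expansion_def by (blast intro: spaced_imp_count_position_le_1)
  have "card {i \<in> {j..<j + w}. digit \<mu> i \<noteq> 0} \<le> 1" for j
  proof -
    have "m = n" if m: "m \<in> {j..<j + w}" "digit \<mu> m \<noteq> 0"
      and n: "n \<in> {j..<j + w}" "digit \<mu> n \<noteq> 0" for m n
    proof (rule ccontr)
      assume "m \<noteq> n"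
      have "(digit \<mu> m, m) \<in># \<mu>" "(digit \<mu> n, n) \<in># \<mu>"
        using ex m n by (auto intro: digit_nonzeroD)
      with \<open>m \<noteq> n\<close> obtain \<nu> where "\<mu> = add_mset (digit \<mu> m, m) (add_mset (digit \<mu> n, n) \<nu>)"
        by (metis insert_noteq_member multi_member_split prod.inject)
      then have "spaced w (add_mset (digit \<mu> m, m) (add_mset (digit \<mu> n, n) \<nu>))"
        using R by simp
      with m n show False by (auto simp: spaced_add_mset)
    qed
    then show ?thesis by (simp add: card_le_Suc0_iff_eq)
  qed
  with ex show "w_NAF_expansion w D \<mu>" by (simp add: w_NAF_expansion_def)
qed

lemma w_NAF_expansion_singleton:
  "w > 0 \<Longrightarrow> s \<in> singletons D \<Longrightarrow> w_NAF_expansion w D {#s#}"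
  by (simp add: w_NAF_expansion_iff_spaced spaced_add_mset)

lemma spaced_add_lowest:
  "spaced w \<mu> \<Longrightarrow> above (snd x + w) \<mu> \<Longrightarrow> spaced w (add_mset x \<mu>)"
  by (auto simp: spaced_add_mset above_def)

lemma spaced_obtain_lowest:
  assumes "spaced w \<mu>" "\<mu> \<noteq> {#}"
  obtains y \<nu> where "\<mu> = add_mset y \<nu>" "above (snd y + w) \<nu>"
proof -
  obtain y where y: "y \<in># \<mu>" and least: "\<And>v. v \<in># \<mu> \<Longrightarrow> snd y \<le> snd v"
    using assms(2) ex_has_least_nat[of "\<lambda>v. v \<in># \<mu>" _ snd] by (metis multiset_nonemptyE)
  then obtain \<nu> where \<nu>: "\<mu> = add_mset y \<nu>" by (meson multi_member_split)
  have "snd y + w \<le> snd v" if "v \<in># \<nu>" for v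
    using assms(1) that least[of v] by (auto simp: \<nu> spaced_add_mset)
  with \<nu> show thesis by (intro that) (auto simp: above_def)
qed

section \<open>Shifting positions\<close>

definition shift :: "nat \<Rightarrow> ('a \<times> nat) multiset \<Rightarrow> ('a \<times> nat) multiset" where
  "shift p = image_mset (apsnd ((+) p))"

lemma size_shift [simp]: "size (shift p \<mu>) = size \<mu>"
  by (simp add: shift_def)

lemma multi_expansion_shift [simp]: "multi_expansion D (shift p \<mu>) \<longleftrightarrow> multi_expansion D \<mu>"
  by (auto simp: multi_expansion_def shift_def singletons_def image_subset_iff)

lemma above_shift: "above p (shift p \<mu>)"
  by (auto simp: above_def shift_def)

lemma spaced_shift: "spaced w \<mu> \<Longrightarrow> spaced w (shift p \<mu>)"
  by (induction \<mu>) (auto simp: shift_def spaced_add_mset)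

lemma above_obtain_shift:
  assumes "above p \<mu>"
  obtains \<nu> where "\<mu> = shift p \<nu>"
proof
  have "image_mset (apsnd ((+) p) \<circ> apsnd (\<lambda>n. n - p)) \<mu> = image_mset id \<mu>"
    using assms by (intro image_mset_cong) (auto simp: above_def)
  then show "\<mu> = shift p (image_mset (apsnd (\<lambda>n. n - p)) \<mu>)"
    by (simp add: shift_def multiset.map_comp)
qed

context pre_number_system
begin

lemma funpow_plus: "(\<Phi> ^^ n) (x + y) = (\<Phi> ^^ n) x + (\<Phi> ^^ n) y"
  by (induction n) (auto simp: add)

lemma funpow_zero: "(\<Phi> ^^ n) 0 = 0"
  by (induction n) (auto simp: zero)

lemma singleton_value_shift:
  "singleton_value \<Phi> (apsnd ((+) p) x) = (\<Phi> ^^ p) (singleton_value \<Phi> x)"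
  by (cases x) (simp add: singleton_value_def funpow_add)

lemma expansion_value_shift:
  "expansion_value \<Phi> (shift p \<mu>) = (\<Phi> ^^ p) (expansion_value \<Phi> \<mu>)"
  by (induction \<mu>) (auto simp: shift_def funpow_zero funpow_plus singleton_value_shift)

lemma expansion_value_in_range:
  "above p \<mu> \<Longrightarrow> expansion_value \<Phi> \<mu> \<in> range (\<Phi> ^^ p)"
  by (erule above_obtain_shift) (simp add: expansion_value_shift)

section \<open>From subadditivity to non-adjacent forms\<close>

text \<open>
  After shifting \<open>s\<close> to position \<open>0\<close>, the sum is \<open>e + \<Phi>\<^sup>k(f)\<close> for nonzero digits \<open>e\<close> and \<open>f\<close>. For
  \<open>k > 0\<close> it lies outside the range of \<open>\<Phi>\<close>, because \<open>e\<close> does, so any multi-expansion of it has a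
  member at position \<open>0\<close>. The shift has to be done first: with \<open>s\<close> at position \<open>p\<close>, the sum
  may well lie in the range of \<open>\<Phi>\<close> iterated \<open>p + 1\<close> times, because \<open>\<Phi>\<close> may fail to be injective.
\<close>
lemma exchange_close_singletons:
  assumes w: "w > 0" and sub: "w_subadditive w \<Phi> D"
    and s: "s \<in> singletons D" and t: "t \<in> singletons D" and st: "snd s \<le> snd t"
  obtains
    (shorter) \<xi> where "multi_expansion D \<xi>" "size \<xi> < 2"
      "expansion_value \<Phi> \<xi> = singleton_value \<Phi> s + singleton_value \<Phi> t"
  | (spaced) a b where "a \<in> singletons D" "b \<in> singletons D"
      "singleton_value \<Phi> a + singleton_value \<Phi> b = singleton_value \<Phi> s + singleton_value \<Phi> t"
      "snd s \<le> snd a" "snd a + w \<le> snd b" "snd s < snd t \<Longrightarrow> snd a = snd s"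
proof -
  obtain e p where se: "s = (e, p)" by (cases s)
  obtain f q where tf: "t = (f, q)" by (cases t)
  define k where "k = q - p"
  have q: "q = p + k" using st by (simp add: k_def se tf)
  have e: "e \<in> D" "e \<noteq> 0" and f: "f \<in> D" "f \<noteq> 0"
    using s t by (auto simp: se tf singletons_def)
  let ?v = "singleton_value \<Phi> (e, 0) + singleton_value \<Phi> (f, k)"
  have total: "(\<Phi> ^^ p) ?v = singleton_value \<Phi> s + singleton_value \<Phi> t"
    using singleton_value_shift[of p "(e, 0)"] singleton_value_shift[of p "(f, k)"]
    by (simp add: funpow_plus se tf q)
  have "(e, 0) \<in> singletons D" "(f, k) \<in> singletons D"
    using e f by (auto simp: singletons_def)
  then obtain \<xi> where \<xi>: "multi_expansion D \<xi>" "spaced w \<xi>" "expansion_value \<Phi> \<xi> = ?v"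
      "size \<xi> \<le> 2"
    using sub w unfolding w_subadditive_def by (metis w_NAF_expansion_iff_spaced)
  show thesis
  proof (cases "size \<xi> < 2")
    case True
    show thesis
      by (rule shorter[of "shift p \<xi>"]) (use True \<xi> total in \<open>auto simp: expansion_value_shift\<close>)
  next
    case False
    then obtain a \<nu> where a: "\<xi> = add_mset a \<nu>" "above (snd a + w) \<nu>"
      using \<xi>(2) by (metis spaced_obtain_lowest size_empty zero_less_numeral)
    have "size \<xi> = 2" using False \<xi>(4) by linarith
    with a have "size \<nu> = Suc 0" by simp
    then obtain b where b: "\<nu> = {#b#}" by (metis One_nat_def size_1_singleton_mset)
    have "snd a = 0" if "k > 0"
    proof (rule ccontr)
      assume "snd a \<noteq> 0"
      then have "above 1 \<xi>" using a b by auto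
      then have "?v \<in> range \<Phi>" using expansion_value_in_range[of 1 \<xi>] \<xi>(3) by simp
      moreover have "singleton_value \<Phi> (f, k) \<in> range \<Phi>"
        using expansion_value_in_range[of 1 "{#(f, k)#}"] that by simp
      moreover have "e = ?v - singleton_value \<Phi> (f, k)"
        by (simp add: singleton_value_def)
      ultimately have "e \<in> range \<Phi>" by (metis (no_types, lifting) diff imageE rangeI)
      with e nonzero_digit_notin_range show False by blast
    qed
    then have "snd (apsnd ((+) p) a) = snd s" if "snd s < snd t"
      using that by (simp add: se tf q)
    moreover have "apsnd ((+) p) a \<in> singletons D" "apsnd ((+) p) b \<in> singletons D"
      using \<xi>(1) a b by (auto simp: singletons_def apsnd_def map_prod_def split: prod.splits)
    moreover have "singleton_value \<Phi> (apsnd ((+) p) a) + singleton_value \<Phi> (apsnd ((+) p) b)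
        = singleton_value \<Phi> s + singleton_value \<Phi> t"
      using \<xi>(3) a b total by (simp add: singleton_value_shift flip: funpow_plus)
    ultimately show thesis
      using a b by (intro spaced[of "apsnd ((+) p) a" "apsnd ((+) p) b"]) (auto simp: se)
  qed
qed

text \<open>
  If \<open>m\<close> is such that the value lies outside the range of \<open>\<Phi>\<^sup>m\<close>, no multi-expansion of that value
  has all its positions at \<open>m\<close> or higher. The predicate \<open>P\<close> is left open to carry side conditions
  such as a bound on the weight.
\<close>
lemma lowest_position_attains_maximum:
  assumes "(\<Inter>m::nat. range (\<Phi> ^^ m)) = {0}" and nz: "expansion_value \<Phi> \<mu> \<noteq> 0"
    and \<mu>: "P \<mu>"
  obtains p \<nu> where "P \<nu>" "expansion_value \<Phi> \<nu> = expansion_value \<Phi> \<mu>" "above p \<nu>"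
    "\<And>\<rho>. P \<rho> \<Longrightarrow> expansion_value \<Phi> \<rho> = expansion_value \<Phi> \<mu> \<Longrightarrow> \<not> above (Suc p) \<rho>"
proof -
  define Q where
    "Q p \<longleftrightarrow> (\<exists>\<nu>. P \<nu> \<and> expansion_value \<Phi> \<nu> = expansion_value \<Phi> \<mu> \<and> above p \<nu>)" for p
  obtain m where m: "expansion_value \<Phi> \<mu> \<notin> range (\<Phi> ^^ m)"
    using assms(1) nz by blast
  have "p \<le> m" if "Q p" for p
  proof (rule ccontr)
    assume "\<not> p \<le> m"
    with that obtain \<nu> where "expansion_value \<Phi> \<nu> = expansion_value \<Phi> \<mu>" "above m \<nu>"
      unfolding Q_def by (meson above_mono nat_le_linear)
    with m expansion_value_in_range show False by metis
  qed
  moreover have "Q 0" using \<mu> by (auto simp: Q_def above_def)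
  ultimately have "Q (GREATEST p. Q p)" "\<not> Q (Suc (GREATEST p. Q p))"
    by (metis GreatestI_nat, metis Greatest_le_nat not_less_eq_eq order_refl)
  then show thesis using that unfolding Q_def by blast
qed

text \<open>
  The induction hypothesis \<open>IH\<close> is first strengthened by shifting, so that a multi-expansion on
  positions at least \<open>p\<close> yields a \<open>w\<close>-NAF on positions at least \<open>p\<close>. This is what keeps the parts
  obtained from it away from the singleton that has been split off.
\<close>
theorem subadditive_imp_NAF_of_multi_expansion:
  assumes inter: "(\<Inter>m::nat. range (\<Phi> ^^ m)) = {0}" and w: "w > 0"
    and sub: "w_subadditive w \<Phi> D" and "multi_expansion D \<mu>"
  shows "\<exists>\<xi>. w_NAF_expansion w D \<xi> \<and> expansion_value \<Phi> \<xi> = expansion_value \<Phi> \<mu> \<and>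
    size \<xi> \<le> size \<mu>"
  using assms(4)
proof (induction "size \<mu>" arbitrary: \<mu> rule: less_induct)
  case less
  let ?k = "size \<mu>" and ?z = "expansion_value \<Phi> \<mu>"
  let ?goal = "\<exists>\<xi>. w_NAF_expansion w D \<xi> \<and> expansion_value \<Phi> \<xi> = ?z \<and> size \<xi> \<le> ?k"
  have fewer: ?goal
    if "multi_expansion D \<nu>" "expansion_value \<Phi> \<nu> = ?z" "size \<nu> < ?k" for \<nu>
    using less.hyps[OF that(3,1)] that by (metis less_imp_le order_trans)
  have IH: "\<exists>\<xi>. multi_expansion D \<xi> \<and> spaced w \<xi> \<and> above p \<xi> \<and>
      expansion_value \<Phi> \<xi> = expansion_value \<Phi> \<nu> \<and> size \<xi> \<le> size \<nu>"
    if smaller: "multi_expansion D \<nu>" "size \<nu> < ?k" "above p \<nu>" for \<nu> p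
  proof -
    obtain \<nu>' where \<nu>': "\<nu> = shift p \<nu>'" using \<open>above p \<nu>\<close> above_obtain_shift by metis
    then obtain \<xi> where "multi_expansion D \<xi>" "spaced w \<xi>"
        "expansion_value \<Phi> \<xi> = expansion_value \<Phi> \<nu>'" "size \<xi> \<le> size \<nu>'"
      using less.hyps[of \<nu>'] smaller(1,2) w_NAF_expansion_iff_spaced[OF w] by auto
    then show ?thesis
      by (intro exI[of _ "shift p \<xi>"])
        (simp add: \<nu>' above_shift spaced_shift expansion_value_shift)
  qed
  have add_lowest: ?goal
    if "x \<in> singletons D" "multi_expansion D \<tau>" "spaced w \<tau>" "above (snd x + w) \<tau>"
      "singleton_value \<Phi> x + expansion_value \<Phi> \<tau> = ?z" "size \<tau> < ?k" for x \<tau>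
    using that w
    by (intro exI[of _ "add_mset x \<tau>"])
      (auto simp: w_NAF_expansion_iff_spaced spaced_add_lowest)
  show ?case
  proof (cases "?z = 0")
    case True
    with w show ?thesis
      by (intro exI[of _ "{#}"]) (simp add: w_NAF_expansion_iff_spaced)
  next
    case False
    obtain p \<nu> where \<nu>: "multi_expansion D \<nu>" "size \<nu> \<le> ?k" "expansion_value \<Phi> \<nu> = ?z"
        "above p \<nu>"
      and max: "\<And>\<rho>. multi_expansion D \<rho> \<Longrightarrow> size \<rho> \<le> ?k \<Longrightarrow> expansion_value \<Phi> \<rho> = ?z \<Longrightarrow>
        \<not> above (Suc p) \<rho>"
      using lowest_position_attains_maximum
        [OF inter False, of "\<lambda>\<nu>. multi_expansion D \<nu> \<and> size \<nu> \<le> ?k"] less.prems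
      by (metis order_refl)
    obtain x where "x \<in># \<nu>" and xp: "snd x = p"
      using max[OF \<nu>(1-3)] \<nu>(4) unfolding above_def by (metis le_antisym not_less_eq_eq)
    then obtain \<rho>\<^sub>0 where \<rho>\<^sub>0: "\<nu> = add_mset x \<rho>\<^sub>0" by (meson multi_member_split)
    with \<nu> have x: "x \<in> singletons D" by simp
    obtain \<rho> where \<rho>: "multi_expansion D \<rho>" "spaced w \<rho>" "above p \<rho>" "size \<rho> < ?k"
        "singleton_value \<Phi> x + expansion_value \<Phi> \<rho> = ?z"
      using IH[of \<rho>\<^sub>0 p] \<nu> by (auto simp: \<rho>\<^sub>0)
    show ?thesis
    proof (cases "above (p + w) \<rho>")
      case True
      with \<rho> x xp show ?thesis by (intro add_lowest[of x \<rho>]) auto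
    next
      case False
      with \<rho>(2) obtain y \<sigma> where y\<sigma>: "\<rho> = add_mset y \<sigma>" "above (snd y + w) \<sigma>"
        using spaced_obtain_lowest by (metis above_simps(1))
      with \<rho> have y: "y \<in> singletons D" "snd x \<le> snd y" and \<sigma>: "multi_expansion D \<sigma>"
        by (auto simp: xp)
      from y\<sigma>(2) y(2) xp have \<sigma>_above: "above (p + w) \<sigma>"
        by (auto elim: above_mono)
      have size_\<sigma>: "size \<sigma> + 2 \<le> ?k" using \<rho>(4) by (simp add: y\<sigma>)
      have z: "singleton_value \<Phi> x + singleton_value \<Phi> y + expansion_value \<Phi> \<sigma> = ?z"
        using \<rho>(5) by (simp add: y\<sigma> add.assoc)
      from w sub x y show ?thesis
      proof (cases rule: exchange_close_singletons)
        case (shorter \<xi>)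
        then show ?thesis
          using \<sigma> size_\<sigma> z by (intro fewer[of "\<xi> + \<sigma>"]) auto
      next
        case (spaced a b)
        have z': "expansion_value \<Phi> (add_mset a (add_mset b \<sigma>)) = ?z"
          using spaced(3) z by (simp flip: add.assoc)
        \<comment> \<open>Were \<open>a\<close> above \<open>p\<close>, then \<open>x\<close> and \<open>y\<close> both sat at \<open>p\<close> and have been replaced by
          singletons further up, which contradicts the maximality of \<open>p\<close>.\<close>
        have "snd a = p"
        proof (rule ccontr)
          assume "snd a \<noteq> p"
          then have "above (Suc p) (add_mset a (add_mset b \<sigma>))"
            using spaced(4,5) xp w above_mono[OF \<sigma>_above, of "Suc p"] by auto
          then show False
            using max[of "add_mset a (add_mset b \<sigma>)"] spaced(1,2) \<sigma> size_\<sigma> z' by auto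
        qed
        moreover obtain \<tau> where "multi_expansion D \<tau>" "spaced w \<tau>" "above (p + w) \<tau>"
            "expansion_value \<Phi> \<tau> = expansion_value \<Phi> (add_mset b \<sigma>)" "size \<tau> < ?k"
          using IH[of "add_mset b \<sigma>" "p + w"] spaced(2,5) \<sigma> \<sigma>_above size_\<sigma> calculation
          by fastforce
        ultimately show ?thesis
          using spaced(1) z' by (intro add_lowest[of a \<tau>]) auto
      qed
    qed
  qed
qed

end

section \<open>The equivalence\<close>

theorem theorem3p2:
  fixes \<Phi> :: "'a::ab_group_add \<Rightarrow> 'a" and D :: "'a set" and w :: nat
  assumes "pre_number_system \<Phi> D"
    and "(\<Inter>m::nat. range (\<Phi> ^^ m)) = {0}"
    and "w > 0"
  defines "stmt_i \<equiv> w_subadditive w \<Phi> D"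
    and "stmt_ii \<equiv> \<forall>\<mu>. multi_expansion D \<mu> \<longrightarrow>
      (\<exists>\<xi>. w_NAF_expansion w D \<xi> \<and> expansion_value \<Phi> \<xi> = expansion_value \<Phi> \<mu> \<and>
        weight \<xi> \<le> weight \<mu>)"
    and "stmt_iii \<equiv> \<forall>\<eta> \<theta>. w_NAF_expansion w D \<eta> \<and> w_NAF_expansion w D \<theta> \<longrightarrow>
      (\<exists>\<xi>. w_NAF_expansion w D \<xi> \<and>
        expansion_value \<Phi> \<xi> = expansion_value \<Phi> \<eta> + expansion_value \<Phi> \<theta> \<and>
        weight \<xi> \<le> weight \<eta> + weight \<theta>)"
    and "stmt_iv \<equiv> \<forall>z. (\<exists>\<mu>. multi_expansion D \<mu> \<and> expansion_value \<Phi> \<mu> = z) \<longrightarrow>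
      (\<exists>\<xi>. w_NAF_expansion w D \<xi> \<and> expansion_value \<Phi> \<xi> = z \<and> optimal \<Phi> D \<xi>)"
  shows "(stmt_i \<longleftrightarrow> stmt_ii) \<and> (stmt_ii \<longleftrightarrow> stmt_iii) \<and> (stmt_iii \<longleftrightarrow> stmt_iv)"
proof -
  interpret pre_number_system \<Phi> D by fact
  note naf = w_NAF_expansion_iff_spaced[OF \<open>w > 0\<close>]
  have i_ii: stmt_ii if stmt_i
    using subadditive_imp_NAF_of_multi_expansion[OF assms(2,3)] that
    unfolding stmt_i_def stmt_ii_def by blast
  have ii_iii: stmt_iii if stmt_ii
    unfolding stmt_iii_def
  proof (intro allI impI)
    fix \<eta> \<theta> :: "('a \<times> nat) multiset"
    assume "w_NAF_expansion w D \<eta> \<and> w_NAF_expansion w D \<theta>"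
    then have "multi_expansion D (\<eta> + \<theta>)" by (simp add: naf)
    then show "\<exists>\<xi>. w_NAF_expansion w D \<xi> \<and>
        expansion_value \<Phi> \<xi> = expansion_value \<Phi> \<eta> + expansion_value \<Phi> \<theta> \<and>
        weight \<xi> \<le> weight \<eta> + weight \<theta>"
      using that unfolding stmt_ii_def by fastforce
  qed
  have iii_i: stmt_i if stmt_iii
    unfolding stmt_i_def w_subadditive_def
  proof (intro ballI)
    fix s t assume "s \<in> singletons D" "t \<in> singletons D"
    then have "w_NAF_expansion w D {#s#}" "w_NAF_expansion w D {#t#}"
      using \<open>w > 0\<close> by (auto intro: w_NAF_expansion_singleton)
    then obtain \<xi> where "w_NAF_expansion w D \<xi>"
        "expansion_value \<Phi> \<xi> = expansion_value \<Phi> {#s#} + expansion_value \<Phi> {#t#}"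
        "weight \<xi> \<le> weight {#s#} + weight {#t#}"
      using \<open>stmt_iii\<close> unfolding stmt_iii_def by blast
    then show "\<exists>\<xi>. w_NAF_expansion w D \<xi> \<and>
        expansion_value \<Phi> \<xi> = singleton_value \<Phi> s + singleton_value \<Phi> t \<and> weight \<xi> \<le> 2"
      by (intro exI[of _ \<xi>]) simp
  qed
  have ii_iv: stmt_iv if stmt_ii
    unfolding stmt_iv_def
  proof (intro allI impI)
    fix z assume "\<exists>\<mu>. multi_expansion D \<mu> \<and> expansion_value \<Phi> \<mu> = z"
    then obtain \<mu> where \<mu>: "multi_expansion D \<mu>" "expansion_value \<Phi> \<mu> = z"
      and least: "\<And>\<nu>. multi_expansion D \<nu> \<Longrightarrow> expansion_value \<Phi> \<nu> = z \<Longrightarrow> weight \<mu> \<le> weight \<nu>"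
      using ex_has_least_nat
        [of "\<lambda>\<mu>. multi_expansion D \<mu> \<and> expansion_value \<Phi> \<mu> = z" _ size] by blast
    obtain \<xi> where "w_NAF_expansion w D \<xi>" "expansion_value \<Phi> \<xi> = z" "weight \<xi> \<le> weight \<mu>"
      using \<open>stmt_ii\<close> \<mu> unfolding stmt_ii_def by metis
    then show "\<exists>\<xi>. w_NAF_expansion w D \<xi> \<and> expansion_value \<Phi> \<xi> = z \<and> optimal \<Phi> D \<xi>"
      using least by (intro exI[of _ \<xi>]) (force simp: optimal_def naf)
  qed
  have iv_ii: stmt_ii if stmt_iv
    using that unfolding stmt_iv_def stmt_ii_def optimal_def by metis
  show ?thesis using i_ii ii_iii iii_i ii_iv iv_ii by blast
qed

end
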